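(* For every stable allocation instance with rational data (quotas, capacities) and every given feasible rational allocation $x$, there is a finite sequence of better response steps starting from $x$ that leads to a stable allocation.
   Context: A stable allocation instance consists of a bipartite graph $G=(V,E)$ with color classes $J$ (jobs, the active side) and $M$ (machines, the passive side), quotas $q:V\to\mathbb{R}_{\ge 0}$, edge capacities $c:E\to\mathbb{R}_{\ge 0}$, and for every vertex $v$ a strict ranking $\mathrm{rank}_v$ of its incident edges ($v$ prefers $uv$ to $wv$ if $\mathrm{rank}_v(uv)<\mathrm{rank}_v(wv)$). An allocation is $x:E\to\mathbb{R}_{\ge0}$ with $x(e)\le c(e)$ for all $e$ and $x(v):=\sum_{e\in\delta(v)}x(e)\le q(v)$ for all $v$. An edge $jm$ ($j\in J$, $m\in M$) blocks $x$ if (1) $x(jm)<c(jm)$; (2) $x(j)<q(j)$ or $j$ prefers $jm$ to its worst edge with positive value in $x$; (3) $x(m)<q(m)$ or $m$ prefers $jm$ to its worst edge with positive value in $x$. An allocation is stable if no edge blocks it. A better response step: a job $j$ chooses an arbitrary blocking edge $jm$ and increases $x(jm)$; simultaneously $j$ and $m$ may decrease allocation only on edges that they rank worse than $jm$, such that the result is again a feasible allocation. *)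

theory Defs
  imports Complex_Main
begin

text \<open>
  An edge between a job \<open>j\<close> and a machine \<open>m\<close> is the pair \<open>(j, m)\<close>. Quotas, capacities and
  ranks are total functions of which only the values on vertices, on edges, and on edges
  incident with the vertex in question matter.
\<close>

record 'v allocation_instance =
  jobs :: "'v set"
  machines :: "'v set"
  edges :: "('v \<times> 'v) set"
  quota :: "'v \<Rightarrow> real"
  capacity :: "'v \<times> 'v \<Rightarrow> real"
  edge_rank :: "'v \<Rightarrow> 'v \<times> 'v \<Rightarrow> nat"

definition vertices :: "'v allocation_instance \<Rightarrow> 'v set" where
  "vertices I = jobs I \<union> machines I"

definition incident_edges :: "'v allocation_instance \<Rightarrow> 'v \<Rightarrow> ('v \<times> 'v) set" where
  "incident_edges I v = {e \<in> edges I. fst e = v \<or> snd e = v}"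

definition valid_instance :: "'v allocation_instance \<Rightarrow> bool" where
  "valid_instance I \<longleftrightarrow>
     finite (vertices I) \<and>
     jobs I \<inter> machines I = {} \<and>
     edges I \<subseteq> jobs I \<times> machines I \<and>
     (\<forall>v\<in>vertices I. 0 \<le> quota I v) \<and>
     (\<forall>e\<in>edges I. 0 \<le> capacity I e) \<and>
     (\<forall>v\<in>vertices I. inj_on (edge_rank I v) (incident_edges I v))"

definition prefers :: "'v allocation_instance \<Rightarrow> 'v \<Rightarrow> 'v \<times> 'v \<Rightarrow> 'v \<times> 'v \<Rightarrow> bool" where
  "prefers I v e f \<longleftrightarrow> edge_rank I v e < edge_rank I v f"

definition load :: "'v allocation_instance \<Rightarrow> ('v \<times> 'v \<Rightarrow> real) \<Rightarrow> 'v \<Rightarrow> real" where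
  "load I x v = (\<Sum>e\<in>incident_edges I v. x e)"

definition feasible_allocation :: "'v allocation_instance \<Rightarrow> ('v \<times> 'v \<Rightarrow> real) \<Rightarrow> bool" where
  "feasible_allocation I x \<longleftrightarrow>
     (\<forall>e\<in>edges I. 0 \<le> x e \<and> x e \<le> capacity I e) \<and>
     (\<forall>v\<in>vertices I. load I x v \<le> quota I v)"

definition is_worst_positive_edge ::
  "'v allocation_instance \<Rightarrow> ('v \<times> 'v \<Rightarrow> real) \<Rightarrow> 'v \<Rightarrow> 'v \<times> 'v \<Rightarrow> bool" where
  "is_worst_positive_edge I x v f \<longleftrightarrow>
     f \<in> incident_edges I v \<and> 0 < x f \<and>
     (\<forall>e\<in>incident_edges I v. 0 < x e \<longrightarrow> edge_rank I v e \<le> edge_rank I v f)"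

text \<open>
  If \<open>v\<close> has no incident edge with positive value, there is no worst such edge, and the second
  disjunct below is false (this matters only for saturated vertices with quota \<open>0\<close>).
\<close>

definition wants_edge ::
  "'v allocation_instance \<Rightarrow> ('v \<times> 'v \<Rightarrow> real) \<Rightarrow> 'v \<Rightarrow> 'v \<times> 'v \<Rightarrow> bool" where
  "wants_edge I x v e \<longleftrightarrow>
     load I x v < quota I v \<or> (\<exists>f. is_worst_positive_edge I x v f \<and> prefers I v e f)"

definition blocks ::
  "'v allocation_instance \<Rightarrow> ('v \<times> 'v \<Rightarrow> real) \<Rightarrow> 'v \<Rightarrow> 'v \<Rightarrow> bool" where
  "blocks I x j m \<longleftrightarrow>
     (j, m) \<in> edges I \<and> x (j, m) < capacity I (j, m) \<and>
     wants_edge I x j (j, m) \<and> wants_edge I x m (j, m)"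

definition stable_allocation :: "'v allocation_instance \<Rightarrow> ('v \<times> 'v \<Rightarrow> real) \<Rightarrow> bool" where
  "stable_allocation I x \<longleftrightarrow> feasible_allocation I x \<and> (\<nexists>j m. blocks I x j m)"

text \<open>
  The amount of the increase is arbitrary. All values outside the edges
  that may be changed, including the irrelevant ones at pairs that are not edges, stay the same.
\<close>

definition better_response_step ::
  "'v allocation_instance \<Rightarrow> ('v \<times> 'v \<Rightarrow> real) \<Rightarrow> ('v \<times> 'v \<Rightarrow> real) \<Rightarrow> bool" where
  "better_response_step I x y \<longleftrightarrow>
     (\<exists>j m. blocks I x j m \<and> x (j, m) < y (j, m) \<and>
        (\<forall>e. e \<noteq> (j, m) \<longrightarrow>
           y e = x e \<or>
           y e < x e \<and>
             (e \<in> incident_edges I j \<and> prefers I j (j, m) e \<or>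
              e \<in> incident_edges I m \<and> prefers I m (j, m) e)) \<and>
        feasible_allocation I y)"

end

theory Submission imports Defs begin

text \<open>
  Scale the data so that all values are multiples of \<open>1 / N\<close> and move single units. In a first
  phase, a job that has a positive edge worse than one of its blocking edges shifts a unit
  from the former to the latter; a full machine discards a unit of its worst edge. This
  decreases the sum of the units weighted by the ranks of the jobs. When no such step exists,
  every blocking edge belongs to an unsaturated job. Now let such jobs add a unit to their best
  blocking edge: no job gets a blocking edge that it prefers to one of its positive edges, and the
  machines only improve, so this second phase ends too, and it can end only in a stable allocation.
\<close>

section \<open>Common denominators and termination by a real potential\<close>

lemma common_denominator:
  assumes "finite S" "S \<subseteq> \<rat>"
  shows "\<exists>N::nat. 0 < N \<and> (\<forall>s\<in>S. real N * s \<in> \<int>)"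
  using assms
proof (induction S rule: finite_induct)
  case empty
  show ?case by (intro exI[of _ 1]) simp
next
  case (insert a S)
  then obtain N where N: "0 < N" "\<forall>s\<in>S. real N * s \<in> \<int>" by auto
  obtain p q :: int where pq: "q > 0" "a = of_int p / of_int q"
    using insert.prems by (auto elim: Rats_cases')
  have "real (N * nat q) * s \<in> \<int>" if "s \<in> insert a S" for s
  proof (cases "s = a")
    case True
    have "real (N * nat q) * s = of_int (int N * p)" using True pq by simp
    then show ?thesis by (metis Ints_of_int)
  next
    case False
    then have "real N * s \<in> \<int>" using that N by blast
    then have "of_int q * (real N * s) \<in> \<int>" by (rule Ints_mult[OF Ints_of_int])
    moreover have "real (N * nat q) * s = of_int q * (real N * s)" using pq(1) by (simp add: of_nat_nat)
    ultimately show ?thesis by (simp only:)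
  qed
  moreover have "0 < N * nat q" using N pq by simp
  ultimately show ?case by blast
qed

text \<open>Measured in multiples of \<open>d\<close> and rounded down, a nonnegative potential is a
  natural number that drops at every step. Both phases terminate by this argument; \<open>P\<close>
  is the invariant carried along and \<open>Q\<close> the goal.\<close>

lemma uniform_descent:
  fixes \<Phi> :: "'a \<Rightarrow> real"
  assumes "0 < d" and "P x"
    and nonneg: "\<And>x. P x \<Longrightarrow> 0 \<le> \<Phi> x"
    and step: "\<And>x. P x \<Longrightarrow> \<not> Q x \<Longrightarrow> \<exists>y. R x y \<and> P y \<and> \<Phi> y \<le> \<Phi> x - d"
  shows "\<exists>y. R\<^sup>*\<^sup>* x y \<and> P y \<and> Q y"
  using \<open>P x\<close>
proof (induction "nat \<lfloor>\<Phi> x / d\<rfloor>" arbitrary: x rule: less_induct)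
  case less
  show ?case
  proof (cases "Q x")
    case True
    then show ?thesis using less.prems by blast
  next
    case False
    then obtain y where y: "R x y" "P y" "\<Phi> y \<le> \<Phi> x - d" using step less.prems by blast
    have "\<Phi> y / d \<le> (\<Phi> x - d) / d" using y(3) \<open>0 < d\<close> by (intro divide_right_mono) auto
    then have "\<Phi> y / d \<le> \<Phi> x / d - 1" using \<open>0 < d\<close> by (simp add: diff_divide_distrib)
    \<comment> \<open>Nonnegativity at \<open>y\<close> forces \<open>\<Phi> x / d\<close> to be at
      least 1, so truncation by \<open>nat\<close> keeps the decrease strict.\<close>
    moreover have "0 \<le> \<Phi> y / d" using nonneg[OF y(2)] \<open>0 < d\<close> by simp
    ultimately have "nat \<lfloor>\<Phi> y / d\<rfloor> < nat \<lfloor>\<Phi> x / d\<rfloor>" by linarith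
    from less.hyps[OF this y(2)] y(1) show ?thesis
      by (meson converse_rtranclp_into_rtranclp)
  qed
qed

text \<open>Distinct integers differ by at least 1. Hence any slack under a quota or a capacity, and
  any positive value, has room for a whole unit.\<close>

lemma add_unit_le:
  fixes a b :: real
  assumes "0 < N" "real N * a \<in> \<int>" "real N * b \<in> \<int>" "a < b"
  shows "a + 1 / real N \<le> b"
proof -
  obtain k l where kl: "real N * a = of_int k" "real N * b = of_int l"
    using assms by (auto elim!: Ints_cases)
  have "real N * a < real N * b" using assms by simp
  then have "k < l" using kl by simp
  then have "real N * a + 1 \<le> real N * b" using kl by linarith
  then show ?thesis using \<open>0 < N\<close> by (simp add: field_simps)
qed

section \<open>Allocations on the grid of multiples of \<open>1 / N\<close> and moves of single
  units\<close>

locale grid_instance =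
  fixes I :: "'v allocation_instance" and N :: nat
  assumes valid: "valid_instance I"
    and N_pos: "0 < N"
    and quota_grid: "v \<in> vertices I \<Longrightarrow> real N * quota I v \<in> \<int>"
    and capacity_grid: "e \<in> edges I \<Longrightarrow> real N * capacity I e \<in> \<int>"
begin

definition grid_allocation :: "('v \<times> 'v \<Rightarrow> real) \<Rightarrow> bool" where
  "grid_allocation x \<longleftrightarrow> feasible_allocation I x \<and> (\<forall>e\<in>edges I. real N * x e \<in> \<int>)"

text \<open>One formula serves both phases: \<open>a\<close> is the blocking edge, and
  \<open>D\<close> collects the edge discarded by the machine, if any, together with, in the first
  phase only, the edge from which the job withdraws.\<close>

definition shift_unit ::
  "'v \<times> 'v \<Rightarrow> ('v \<times> 'v) set \<Rightarrow> ('v \<times> 'v \<Rightarrow> real) \<Rightarrow> 'v \<times> 'v \<Rightarrow> real" where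
  "shift_unit a D x e =
     (if e = a then x e + 1 / N else if e \<in> D then x e - 1 / N else x e)"

lemma finite_edges: "finite (edges I)"
  using valid unfolding valid_instance_def vertices_def
  by (meson finite_SigmaI finite_Un finite_subset)

lemma finite_incident_edges: "finite (incident_edges I v)"
  unfolding incident_edges_def using finite_edges by simp

lemma edge_ends:
  assumes "(j, m) \<in> edges I"
  shows "j \<in> vertices I" "m \<in> vertices I" "j \<noteq> m"
  using assms valid unfolding valid_instance_def vertices_def by blast+

lemma jobs_machines:
  assumes "(j, m) \<in> edges I" "(m, m') \<in> edges I"
  shows False
  using assms valid unfolding valid_instance_def by blast

lemma incident_job_iff:
  assumes "(j, m) \<in> edges I"
  shows "e \<in> incident_edges I j \<longleftrightarrow> e \<in> edges I \<and> fst e = j"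
  using assms jobs_machines[of "fst e" j m] unfolding incident_edges_def by (cases e) auto

lemma incident_machine_iff:
  assumes "(j, m) \<in> edges I"
  shows "e \<in> incident_edges I m \<longleftrightarrow> e \<in> edges I \<and> snd e = m"
  using assms jobs_machines[of j m "snd e"] unfolding incident_edges_def by (cases e) auto

text \<open>Among the finitely many positive edges at \<open>v\<close> one has maximal rank, so if
  any of them is worse than \<open>e\<close>, the worst one is. A wish is thus certified by a single
  positive edge, which is easy to carry from one allocation to another.\<close>

lemma wants_edge_iff:
  "wants_edge I x v e \<longleftrightarrow> load I x v < quota I v \<or>
     (\<exists>f\<in>incident_edges I v. 0 < x f \<and> edge_rank I v e < edge_rank I v f)"
proof -
  have "\<exists>g. is_worst_positive_edge I x v g \<and> edge_rank I v e < edge_rank I v g"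
    if f: "f \<in> incident_edges I v" "0 < x f" "edge_rank I v e < edge_rank I v f" for f
  proof -
    let ?S = "{g \<in> incident_edges I v. 0 < x g}"
    have fin: "finite (edge_rank I v ` ?S)" using finite_incident_edges by simp
    have ne: "edge_rank I v ` ?S \<noteq> {}" using f by blast
    obtain g where g: "g \<in> ?S" "Max (edge_rank I v ` ?S) = edge_rank I v g"
      using Max_in[OF fin ne] by blast
    have "edge_rank I v h \<le> edge_rank I v g" if "h \<in> ?S" for h
      using Max_ge[OF fin, of "edge_rank I v h"] that g by simp
    then have "is_worst_positive_edge I x v g" "edge_rank I v f \<le> edge_rank I v g"
      using g f by (simp_all add: is_worst_positive_edge_def)
    then show ?thesis using f(3) by (meson less_le_trans)
  qed
  then show ?thesis unfolding wants_edge_def prefers_def is_worst_positive_edge_def by blast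
qed

text \<open>The weight \<open>g\<close> is arbitrary so that the same computation gives the loads,
  with weight 1, and the changes of both potentials, with weights built from ranks.\<close>

lemma sum_shift_unit:
  assumes "finite A" "a \<notin> D"
  shows "(\<Sum>e\<in>A. g e * shift_unit a D x e) =
    (\<Sum>e\<in>A. g e * x e) + ((if a \<in> A then g a else 0) - sum g (A \<inter> D)) / N"
proof -
  have "(\<Sum>e\<in>A. g e * shift_unit a D x e) =
    (\<Sum>e\<in>A. g e * x e + ((if e = a then g e else 0) - (if e \<in> D then g e else 0)) / N)"
    using assms(2) by (intro sum.cong) (auto simp: shift_unit_def algebra_simps)
  also have "\<dots> = (\<Sum>e\<in>A. g e * x e) +
      ((\<Sum>e\<in>A. if e = a then g e else 0) - (\<Sum>e\<in>A. if e \<in> D then g e else 0)) / N"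
    by (simp only: sum.distrib sum_divide_distrib[symmetric] sum_subtractf)
  finally show ?thesis using assms(1) by (simp add: sum.inter_restrict sum.delta)
qed

lemma load_shift_unit:
  assumes "a \<notin> D"
  shows "load I (shift_unit a D x) v = load I x v +
    ((if a \<in> incident_edges I v then 1 else 0) - real (card (incident_edges I v \<inter> D))) / N"
  using sum_shift_unit[OF finite_incident_edges assms, of "\<lambda>_. 1" x v]
  by (simp add: load_def)

lemma grid_load:
  assumes "grid_allocation x"
  shows "real N * load I x v \<in> \<int>"
  unfolding load_def sum_distrib_left
  using assms by (intro Ints_sum) (auto simp: grid_allocation_def incident_edges_def)

text \<open>On the grid, slack at an end of the blocking edge is at least one unit; without slack,
  an edge of \<open>D\<close> at that end pays for the added unit. All other vertices can only lose
  load.\<close>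

lemma shift_unit_step:
  assumes x: "grid_allocation x" and bl: "blocks I x j m"
    and D: "D \<subseteq> edges I" "\<And>e. e \<in> D \<Longrightarrow> 0 < x e"
    and worse: "\<And>e. e \<in> D \<Longrightarrow> e \<in> incident_edges I j \<and> prefers I j (j, m) e \<or>
              e \<in> incident_edges I m \<and> prefers I m (j, m) e"
    and room: "\<And>v. v \<in> {j, m} \<Longrightarrow> load I x v < quota I v \<or> incident_edges I v \<inter> D \<noteq> {}"
  shows "better_response_step I x (shift_unit (j, m) D x) \<and>
    grid_allocation (shift_unit (j, m) D x)"
proof -
  let ?y = "shift_unit (j, m) D x"
  have jm: "(j, m) \<in> edges I" "x (j, m) < capacity I (j, m)"
    using bl by (auto simp: blocks_def)
  have nD: "(j, m) \<notin> D" using worse unfolding prefers_def by blast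
  have xE: "0 \<le> x e" "x e \<le> capacity I e" "real N * x e \<in> \<int>" if "e \<in> edges I" for e
    using x that by (auto simp: grid_allocation_def feasible_allocation_def)
  have u: "1 / real N > 0" using N_pos by simp
  have "0 \<le> ?y e \<and> ?y e \<le> capacity I e \<and> real N * ?y e \<in> \<int>" if e: "e \<in> edges I" for e
  proof -
    have up: "x e + 1 / N \<le> capacity I e" if "e = (j, m)"
      using that jm add_unit_le[OF N_pos xE(3) capacity_grid] e by blast
    have down: "0 + 1 / N \<le> x e" if "e \<in> D"
      using that D(2) add_unit_le[OF N_pos _ xE(3), of 0] e by auto
    have "real N * (x e + 1 / N) = real N * x e + 1" "real N * (x e - 1 / N) = real N * x e - 1"
      using N_pos by (simp_all add: field_simps)
    then have "real N * (x e + 1 / N) \<in> \<int>" "real N * (x e - 1 / N) \<in> \<int>"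
      using xE(3)[OF e] by simp_all
    then have "real N * ?y e \<in> \<int>" using xE(3)[OF e] unfolding shift_unit_def by presburger
    moreover have "0 \<le> ?y e \<and> ?y e \<le> capacity I e"
      using up down xE[OF e] u unfolding shift_unit_def by (smt (verit))
    ultimately show ?thesis by blast
  qed
  moreover have "load I ?y v \<le> quota I v" if v: "v \<in> vertices I" for v
  proof -
    have q: "load I x v \<le> quota I v"
      using x v by (auto simp: grid_allocation_def feasible_allocation_def)
    let ?k = "card (incident_edges I v \<inter> D)"
    have l: "load I ?y v =
        load I x v + ((if (j, m) \<in> incident_edges I v then 1 else 0) - real ?k) / N"
      by (rule load_shift_unit[OF nD])
    show ?thesis
    \<comment> \<open>The load rises only at an end of \<open>(j, m)\<close> that meets no edge of
      \<open>D\<close>, and there \<open>room\<close> provides slack.\<close>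
    proof (cases "(j, m) \<in> incident_edges I v \<and> ?k = 0")
      case True
      then have "v \<in> {j, m}" "incident_edges I v \<inter> D = {}"
        using finite_incident_edges by (auto simp: incident_edges_def)
      then have "load I x v < quota I v" using room by blast
      then have "load I x v + 1 / N \<le> quota I v"
        using add_unit_le[OF N_pos grid_load[OF x] quota_grid[OF v]] by blast
      then show ?thesis using l True by simp
    next
      case False
      then have "((if (j, m) \<in> incident_edges I v then 1 else 0) - real ?k) / N \<le> 0"
        by (intro divide_nonpos_nonneg) auto
      then show ?thesis using l q by linarith
    qed
  qed
  ultimately have g: "grid_allocation ?y"
    by (auto simp: grid_allocation_def feasible_allocation_def)
  have "?y e = x e \<or> ?y e < x e \<and>
             (e \<in> incident_edges I j \<and> prefers I j (j, m) e \<or>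
              e \<in> incident_edges I m \<and> prefers I m (j, m) e)" if "e \<noteq> (j, m)" for e
    using that worse[of e] u by (auto simp: shift_unit_def)
  moreover have "x (j, m) < ?y (j, m)" using u by (simp add: shift_unit_def)
  ultimately show ?thesis
    using bl g unfolding better_response_step_def grid_allocation_def by blast
qed

text \<open>The goal of the first phase and the invariant of the second.\<close>

definition no_upgrade :: "('v \<times> 'v \<Rightarrow> real) \<Rightarrow> bool" where
  "no_upgrade x \<longleftrightarrow>
     (\<forall>j m f. (j, m) \<in> edges I \<and> x (j, m) < capacity I (j, m) \<and> wants_edge I x m (j, m) \<and>
        f \<in> incident_edges I j \<and> 0 < x f \<longrightarrow> edge_rank I j f \<le> edge_rank I j (j, m))"

text \<open>A machine with slack discards nothing, a saturated one a unit of its worst positive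
  edge. Encoding this as a set \<open>D\<close> with at most one element spares a case split in
  every later move.\<close>

lemma obtain_discarded:
  assumes "wants_edge I x m (j, m)"
  obtains D where "D \<subseteq> incident_edges I m" "finite D" "\<And>e. e \<in> D \<Longrightarrow> 0 < x e"
    "\<And>e. e \<in> D \<Longrightarrow> edge_rank I m (j, m) < edge_rank I m e"
    "\<And>e f. e \<in> D \<Longrightarrow> f \<in> incident_edges I m \<Longrightarrow> 0 < x f \<Longrightarrow> edge_rank I m f \<le> edge_rank I m e"
    "load I x m < quota I m \<and> D = {} \<or> \<not> load I x m < quota I m \<and> card D = 1"
proof (cases "load I x m < quota I m")
  case True
  then show ?thesis by (intro that[of "{}"]) auto
next
  case False
  then obtain w where "is_worst_positive_edge I x m w" "prefers I m (j, m) w"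
    using assms by (auto simp: wants_edge_def)
  then show ?thesis using False
    by (intro that[of "{w}"]) (auto simp: is_worst_positive_edge_def prefers_def)
qed

section \<open>First phase: jobs shift units to better edges\<close>

lemma phase_one:
  assumes "grid_allocation x"
  shows "\<exists>y. (better_response_step I)\<^sup>*\<^sup>* x y \<and> grid_allocation y \<and> no_upgrade y"
\<comment> \<open>The potential weights each unit by its rank at the job. Trading \<open>f\<close>
  for \<open>(j, m)\<close> lowers it by at least \<open>1 / N\<close>, as ranks are natural
  numbers.\<close>
proof (rule uniform_descent[where d = "1 / N" and P = grid_allocation
      and \<Phi> = "\<lambda>x. \<Sum>e\<in>edges I. real (edge_rank I (fst e) e) * x e"])
  show "0 < 1 / real N" using N_pos by simp
  show "grid_allocation x" by fact
next
  fix x assume "grid_allocation x"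
  then show "0 \<le> (\<Sum>e\<in>edges I. real (edge_rank I (fst e) e) * x e)"
    by (intro sum_nonneg) (auto simp: grid_allocation_def feasible_allocation_def)
next
  fix x assume x: "grid_allocation x" and "\<not> no_upgrade x"
  then obtain j m f where jm: "(j, m) \<in> edges I" "x (j, m) < capacity I (j, m)"
    and wm: "wants_edge I x m (j, m)"
    and f: "f \<in> incident_edges I j" "0 < x f" "edge_rank I j (j, m) < edge_rank I j f"
    unfolding no_upgrade_def by fastforce
  \<comment> \<open>The positive edge \<open>f\<close> certifies the wish of \<open>j\<close>, even
    if \<open>j\<close> is saturated.\<close>
  have bl: "blocks I x j m"
    using jm wm f by (auto simp: blocks_def wants_edge_iff[of x j])
  obtain D where D: "D \<subseteq> incident_edges I m" "finite D" "\<And>e. e \<in> D \<Longrightarrow> 0 < x e"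
    "\<And>e. e \<in> D \<Longrightarrow> edge_rank I m (j, m) < edge_rank I m e"
    "load I x m < quota I m \<and> D = {} \<or> \<not> load I x m < quota I m \<and> card D = 1"
    using obtain_discarded[OF wm] by metis
  let ?D = "insert f D"
  let ?y = "shift_unit (j, m) ?D x"
  have sub: "?D \<subseteq> edges I" using D(1) f(1) by (auto simp: incident_edges_def)
  have "better_response_step I x ?y \<and> grid_allocation ?y"
  proof (rule shift_unit_step[OF x bl sub])
    show "0 < x e" if "e \<in> ?D" for e using that D(3) f(2) by blast
    show "e \<in> incident_edges I j \<and> prefers I j (j, m) e \<or>
              e \<in> incident_edges I m \<and> prefers I m (j, m) e" if "e \<in> ?D" for e
      using that D(1,4) f(1,3) unfolding prefers_def by blast
    have "D \<noteq> {}" if "\<not> load I x m < quota I m" using D(5) that by auto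
    then show "load I x v < quota I v \<or> incident_edges I v \<inter> ?D \<noteq> {}" if "v \<in> {j, m}" for v
      using that D(1) f(1) by blast
  qed
  moreover have "(\<Sum>e\<in>edges I. real (edge_rank I (fst e) e) * ?y e) \<le>
      (\<Sum>e\<in>edges I. real (edge_rank I (fst e) e) * x e) - 1 / N"
  proof -
    have nD: "(j, m) \<notin> ?D" using D(4) f(3) by blast
    \<comment> \<open>Only the contribution of \<open>f\<close> has to be counted: the unit
      discarded by \<open>m\<close> belongs to some job whose rank is nonnegative, so it can only
      help.\<close>
    have "real (edge_rank I (fst f) f) \<le> (\<Sum>e\<in>?D. real (edge_rank I (fst e) e))"
      using D(2) by (intro member_le_sum) auto
    moreover have "fst f = j" using f(1) incident_job_iff[OF jm(1)] by blast
    ultimately have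
      "real (edge_rank I j (j, m)) - (\<Sum>e\<in>?D. real (edge_rank I (fst e) e)) \<le> - 1"
      using f(3) by simp
    then have "(real (edge_rank I j (j, m)) - (\<Sum>e\<in>?D. real (edge_rank I (fst e) e))) / N \<le> - 1 / N"
      by (intro divide_right_mono) auto
    moreover have "edges I \<inter> ?D = ?D" using sub by blast
    ultimately show ?thesis
      using jm(1) by (subst sum_shift_unit[OF finite_edges nD]) simp
  qed
  ultimately show "\<exists>y. better_response_step I x y \<and> grid_allocation y \<and>
      (\<Sum>e\<in>edges I. real (edge_rank I (fst e) e) * y e) \<le>
      (\<Sum>e\<in>edges I. real (edge_rank I (fst e) e) * x e) - 1 / N" by blast
qed

section \<open>Second phase: unsaturated jobs add units to their best blocking edges\<close>

text \<open>The step makes no machine less demanding, so an edge with spare capacity that its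
  machine wants afterwards was already such an edge before. The only edge that gains value is
  \<open>(j, m)\<close>, and it was the best choice of \<open>j\<close>.\<close>

lemma no_upgrade_best_response:
  assumes x: "grid_allocation x" and nu: "no_upgrade x" and bl: "blocks I x j m"
    and best: "\<And>m'. blocks I x j m' \<Longrightarrow> edge_rank I j (j, m) \<le> edge_rank I j (j, m')"
    and unsat: "load I x j < quota I j"
    and D: "D \<subseteq> incident_edges I m"
    "\<And>e. e \<in> D \<Longrightarrow> edge_rank I m (j, m) < edge_rank I m e"
    "\<And>e f. e \<in> D \<Longrightarrow> f \<in> incident_edges I m \<Longrightarrow> 0 < x f \<Longrightarrow> edge_rank I m f \<le> edge_rank I m e"
    "load I x m < quota I m \<and> D = {} \<or> \<not> load I x m < quota I m \<and> card D = 1"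
  shows "no_upgrade (shift_unit (j, m) D x)"
  unfolding no_upgrade_def
proof (intro allI impI, elim conjE)
  let ?y = "shift_unit (j, m) D x"
  fix j' m' f
  assume e: "(j', m') \<in> edges I" "?y (j', m') < capacity I (j', m')"
    and wy: "wants_edge I ?y m' (j', m')"
    and f: "f \<in> incident_edges I j'" "0 < ?y f"
  have u: "1 / real N > 0" using N_pos by simp
  have jm: "(j, m) \<in> edges I" using bl by (simp add: blocks_def)
  have nD: "(j, m) \<notin> D" using D(2) by blast
  have le: "?y h \<le> x h" if "h \<noteq> (j, m)" for h
    using that u by (simp add: shift_unit_def)
  have same: "?y h = x h" if "h \<in> edges I" "snd h \<noteq> m" for h
  proof -
    have "h \<notin> D" "h \<noteq> (j, m)"
      using that subsetD[OF D(1), of h] incident_machine_iff[OF jm, of h] by auto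
    then show ?thesis by (simp add: shift_unit_def)
  qed
  \<comment> \<open>Only \<open>m\<close> sees changes. If it had slack in \<open>x\<close>, it
    wanted every edge; if it was saturated, discarding \<open>w\<close> keeps its load, so its wish
    in \<open>?y\<close> must come from a worse positive edge \<open>g\<close>.\<close>
  have wx: "wants_edge I x m' (j', m')"
  proof (cases "m' = m")
    case False
    have eq: "?y h = x h" if "h \<in> incident_edges I m'" for h
      using same[of h] that False incident_machine_iff[OF e(1), of h] by simp
    then have "load I ?y m' = load I x m'"
      unfolding load_def by (intro sum.cong) auto
    then show ?thesis using wy eq unfolding wants_edge_iff by metis
  next
    case True
    show ?thesis
    proof (cases "load I x m < quota I m")
      case True
      then show ?thesis using \<open>m' = m\<close> by (simp add: wants_edge_iff)
    next
      case False
      then obtain w where w: "D = {w}" using D(4) by (auto simp: card_1_singleton_iff)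
      then have "incident_edges I m \<inter> D = {w}" using D(1) by blast
      then have "load I ?y m = load I x m"
        using jm by (subst load_shift_unit[OF nD]) (simp add: incident_edges_def)
      then obtain g where g: "g \<in> incident_edges I m" "0 < ?y g"
        "edge_rank I m (j', m') < edge_rank I m g"
        using wy False \<open>m' = m\<close> by (auto simp: wants_edge_iff)
      show ?thesis
      proof (cases "g = (j, m)")
        case True
        \<comment> \<open>The edge \<open>(j, m)\<close> may be positive only in \<open>?y\<close>,
          so it cannot serve as witness for \<open>x\<close>. But \<open>m\<close> was saturated and
          wanted it, hence had an even worse positive edge \<open>h\<close>.\<close>
        obtain h where "h \<in> incident_edges I m" "0 < x h"
          "edge_rank I m (j, m) < edge_rank I m h"
          using bl False by (auto simp: blocks_def wants_edge_iff)
        then show ?thesis using g(3) True \<open>m' = m\<close> by (auto simp: wants_edge_iff)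
      next
        case False
        then show ?thesis using g le[of g] \<open>m' = m\<close> by (force simp: wants_edge_iff)
      qed
    qed
  qed
  \<comment> \<open>An edge that is full in \<open>x\<close> but not in \<open>?y\<close> is the
    discarded one. For the saturated \<open>m\<close> to want it back, a still worse positive edge
    would be needed, but it was the worst.\<close>
  have cx: "x (j', m') < capacity I (j', m')"
  proof (rule ccontr)
    assume n: "\<not> ?thesis"
    have nj: "(j', m') \<noteq> (j, m)" using n bl by (auto simp: blocks_def)
    have d: "(j', m') \<in> D" using n e(2) nj by (auto simp: shift_unit_def split: if_splits)
    then have m': "m' = m" using D(1) incident_machine_iff[OF jm, of "(j', m')"] by auto
    have full: "\<not> load I x m < quota I m" using D(4) d by auto
    then obtain w where w: "D = {w}" using D(4) by (auto simp: card_1_singleton_iff)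
    then have "incident_edges I m \<inter> D = {w}" using D(1) by blast
    then have "load I ?y m = load I x m"
      using jm by (subst load_shift_unit[OF nD]) (simp add: incident_edges_def)
    then obtain g where g: "g \<in> incident_edges I m" "0 < ?y g"
      "edge_rank I m (j', m') < edge_rank I m g"
      using wy full m' by (auto simp: wants_edge_iff)
    have "g \<noteq> (j, m)" using g(3) D(2)[OF d] by auto
    then have "0 < x g" using g(2) le[of g] by simp
    then show False using D(3)[OF d g(1)] g(3) by simp
  qed
  show "edge_rank I j' f \<le> edge_rank I j' (j', m')"
  \<comment> \<open>The new unit is handled by the choice of \<open>m\<close>: since
    \<open>j\<close> is unsaturated, \<open>(j, m')\<close> blocks \<open>x\<close> as well. Any
    other positive edge was positive before, so the invariant for \<open>x\<close> applies.\<close>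
  proof (cases "f = (j, m)")
    case True
    then have "j' = j" using f(1) incident_job_iff[OF e(1)] by auto
    then have "blocks I x j m'" using e(1) cx wx unsat by (simp add: blocks_def wants_edge_iff[of x j])
    then show ?thesis using best True \<open>j' = j\<close> by blast
  next
    case False
    then have "0 < x f" using f(2) le[of f] by simp
    then show ?thesis using nu e(1) cx wx f(1) unfolding no_upgrade_def by blast
  qed
qed

lemma phase_two:
  assumes "grid_allocation x" "no_upgrade x"
  shows "\<exists>y. (better_response_step I)\<^sup>*\<^sup>* x y \<and> (grid_allocation y \<and> no_upgrade y) \<and>
    stable_allocation I y"
proof -
  define r where "r e = real (edge_rank I (snd e) e)" for e
  \<comment> \<open>\<open>R\<close> exceeds every machine rank by at least 1, so a unit on
    \<open>e\<close> is worth \<open>R - r e\<close>, which is at least 1, to its machine.\<close>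
  define R where "R = sum r (edges I) + 1"
  \<comment> \<open>This is a constant minus the total worth of all units to the machines; the
    constant is large enough to keep the difference nonnegative under the capacities.\<close>
  define \<Phi> where "\<Phi> x = (\<Sum>e\<in>edges I. R * capacity I e) + (\<Sum>e\<in>edges I. (r e - R) * x e)" for x
  have r_less: "r e + 1 \<le> R" if "e \<in> edges I" for e
    unfolding R_def using member_le_sum[of e "edges I" r] that finite_edges by (simp add: r_def)
  show ?thesis
  proof (rule uniform_descent[where d = "1 / N" and \<Phi> = \<Phi>])
    show "0 < 1 / real N" using N_pos by simp
    show "grid_allocation x \<and> no_upgrade x" using assms by blast
  next
    fix x assume "grid_allocation x \<and> no_upgrade x"
    then have x: "0 \<le> x e" "x e \<le> capacity I e" if "e \<in> edges I" for e
      using that by (auto simp: grid_allocation_def feasible_allocation_def)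
    have "0 \<le> R * capacity I e + (r e - R) * x e" if "e \<in> edges I" for e
    proof -
      have "0 \<le> R * (capacity I e - x e) + r e * x e"
        using x[OF that] r_less[OF that] by (intro add_nonneg_nonneg mult_nonneg_nonneg) (auto simp: r_def)
      then show ?thesis by (simp add: algebra_simps)
    qed
    then show "0 \<le> \<Phi> x" unfolding \<Phi>_def sum.distrib[symmetric] by (intro sum_nonneg) auto
  next
    fix x assume xn: "grid_allocation x \<and> no_upgrade x" and "\<not> stable_allocation I x"
    then have x: "grid_allocation x" and nu: "no_upgrade x" by auto
    then obtain j m0 where "blocks I x j m0"
      using \<open>\<not> stable_allocation I x\<close> unfolding stable_allocation_def grid_allocation_def by blast
    then obtain m where bl: "blocks I x j m"
      and best: "\<And>m'. blocks I x j m' \<Longrightarrow> edge_rank I j (j, m) \<le> edge_rank I j (j, m')"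
      using ex_has_least_nat[of "blocks I x j" m0 "\<lambda>m. edge_rank I j (j, m)"] by blast
    have jm: "(j, m) \<in> edges I" and wm: "wants_edge I x m (j, m)"
      using bl by (auto simp: blocks_def)
    \<comment> \<open>A saturated \<open>j\<close> would want \<open>(j, m)\<close> only because of
      a worse positive edge, which the invariant excludes.\<close>
    have unsat: "load I x j < quota I j"
    proof (rule ccontr)
      assume "\<not> ?thesis"
      then obtain f where "f \<in> incident_edges I j" "0 < x f"
        "edge_rank I j (j, m) < edge_rank I j f"
        using bl by (auto simp: blocks_def wants_edge_iff)
      then show False using nu bl unfolding no_upgrade_def blocks_def by (meson not_less)
    qed
    obtain D where D: "D \<subseteq> incident_edges I m" "finite D" "\<And>e. e \<in> D \<Longrightarrow> 0 < x e"
      "\<And>e. e \<in> D \<Longrightarrow> edge_rank I m (j, m) < edge_rank I m e"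
      "\<And>e f. e \<in> D \<Longrightarrow> f \<in> incident_edges I m \<Longrightarrow> 0 < x f \<Longrightarrow> edge_rank I m f \<le> edge_rank I m e"
      "load I x m < quota I m \<and> D = {} \<or> \<not> load I x m < quota I m \<and> card D = 1"
      by (rule obtain_discarded[OF wm]) (rule that; assumption)
    let ?y = "shift_unit (j, m) D x"
    have sub: "D \<subseteq> edges I" using D(1) by (auto simp: incident_edges_def)
    have "better_response_step I x ?y \<and> grid_allocation ?y"
    proof (rule shift_unit_step[OF x bl sub D(3)])
      show "e \<in> incident_edges I j \<and> prefers I j (j, m) e \<or>
              e \<in> incident_edges I m \<and> prefers I m (j, m) e" if "e \<in> D" for e
        using that D(1,4) unfolding prefers_def by blast
      have "D \<noteq> {}" if "\<not> load I x m < quota I m" using D(6) that by auto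
      then show "load I x v < quota I v \<or> incident_edges I v \<inter> D \<noteq> {}" if "v \<in> {j, m}" for v
        using that D(1) unsat by blast
    qed
    moreover have "no_upgrade ?y"
      by (rule no_upgrade_best_response[OF x nu bl best unsat D(1,4,5,6)])
    moreover have "\<Phi> ?y \<le> \<Phi> x - 1 / N"
    proof -
      have nD: "(j, m) \<notin> D" using D(4) by blast
      \<comment> \<open>With nothing discarded, the new unit contributes at most -1 by the choice of
        \<open>R\<close>. Otherwise \<open>R\<close> cancels and what remains is the rank gain of
        \<open>m\<close> over \<open>w\<close>.\<close>
      have "r (j, m) - R - (\<Sum>e\<in>D. r e - R) \<le> - 1"
      proof (cases "D = {}")
        case True
        then show ?thesis using r_less[OF jm] by simp
      next
        case False
        then obtain w where w: "D = {w}" using D(6) by (auto simp: card_1_singleton_iff)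
        then have "snd w = m" using D(1) incident_machine_iff[OF jm, of w] by simp
        then show ?thesis using w D(4)[of w] by (simp add: r_def)
      qed
      then have "(r (j, m) - R - (\<Sum>e\<in>D. r e - R)) / N \<le> - 1 / N"
        by (intro divide_right_mono) auto
      moreover have "edges I \<inter> D = D" using sub by blast
      ultimately show ?thesis unfolding \<Phi>_def
        using jm by (subst sum_shift_unit[OF finite_edges nD]) simp
    qed
    ultimately show "\<exists>y. better_response_step I x y \<and> (grid_allocation y \<and> no_upgrade y) \<and>
        \<Phi> y \<le> \<Phi> x - 1 / N" by blast
  qed
qed

end

theorem theorem2:
  fixes I :: "'v allocation_instance" and x :: "'v \<times> 'v \<Rightarrow> real"
  assumes "valid_instance I"
    and "\<forall>v\<in>vertices I. quota I v \<in> \<rat>"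
    and "\<forall>e\<in>edges I. capacity I e \<in> \<rat>"
    and "feasible_allocation I x"
    and "\<forall>e\<in>edges I. x e \<in> \<rat>"
  shows "\<exists>y. (better_response_step I)\<^sup>*\<^sup>* x y \<and> stable_allocation I y"
proof -
  \<comment> \<open>The denominator must also clear the values of \<open>x\<close>, so that the
    starting allocation lies on the grid.\<close>
  let ?S = "quota I ` vertices I \<union> capacity I ` edges I \<union> x ` edges I"
  have "finite (edges I)"
    using assms(1) unfolding valid_instance_def vertices_def
    by (meson finite_SigmaI finite_Un finite_subset)
  then have fin: "finite ?S" using assms(1) by (simp add: valid_instance_def)
  have "?S \<subseteq> \<rat>" using assms(2,3,5) by blast
  from common_denominator[OF fin this] obtain N :: nat
    where N: "0 < N" "\<forall>s\<in>?S. real N * s \<in> \<int>"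
    by (elim exE conjE)
  interpret grid_instance I N by unfold_locales (use assms(1) N in auto)
  have "grid_allocation x" using assms(4) N by (auto simp: grid_allocation_def)
  then obtain y where y: "(better_response_step I)\<^sup>*\<^sup>* x y" "grid_allocation y" "no_upgrade y"
    using phase_one by blast
  obtain z where "(better_response_step I)\<^sup>*\<^sup>* y z" "stable_allocation I z"
    using phase_two[OF y(2,3)] by blast
  then show ?thesis using y(1) by (meson rtranclp_trans)
qed

end
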